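(* Let $p>1$ be an integer, and let $f:\mathcal X\to\mathbb R$ be differentiable, attain its minimum at $x^\ast$, and be strongly smooth of order $p$ with constants $0<L_1,\dots,L_p<\infty$. Let $\eta>0$ satisfy $0<\eta^{\frac{1}{p-1}}\le\min\left\{1,\frac{1}{2\sum_{m=2}^p L_m/m!}\right\}$, let $\delta>0$ be defined by $\delta^{p-1}=\eta/2^{p-1}$, let $(x_k)_{k\ge0}$ be generated by rescaled gradient descent $$x_{k+1}=x_k-\eta^{\frac{1}{p-1}}\frac{B^{-1}\nabla f(x_k)}{\|\nabla f(x_k)\|_\ast^{\frac{p-2}{p-1}}},$$ and put $E_0:=f(x_0)-f(x^\ast)$. Then: (1) for all $k\ge1$, $\min_{0\le s\le k}\|\nabla f(x_s)\|_\ast\le\left(E_0/(\delta k)\right)^{\frac{p-1}{p}}$; (2) if in addition $f$ is convex and $R:=\sup_{x:f(x)\le f(x_0)}\|x-x^\ast\|<\infty$, then with $c_p:=\frac{(1-1/p)^p}{p-1}$, for all $k\ge0$, $$f(x_k)-f(x^\ast)\le2\left(\frac{1}{E_0^{1/p}}+\frac{1}{R\,c_p^{1/p}\,p}(\delta k)^{\frac{p-1}{p}}\right)^{-p}=O\left(1/\left(1+\tfrac{1}{Rp}(\delta k)^{\frac{p-1}{p}}\right)^{p}\right);$$ (3) if in addition $f$ is $\mu$-uniformly convex of order $p$ with $\mu>0$, then for all $k\ge0$, $$f(x_k)-f(x^\ast)\le E_0\exp\left(-\frac{p}{p-1}\mu^{\frac{1}{p-1}}\delta k\right).$$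
   Context: $\mathcal X$ (identified with $\mathbb R^d$) is a finite-dimensional real vector space with norm $\|v\|=\sqrt{\langle v,Bv\rangle}$ and dual norm $\|s\|_\ast=\sqrt{\langle s,B^{-1}s\rangle}$ on $\mathcal X^\ast$, where $B:\mathcal X\to\mathcal X^\ast$ is a positive definite self-adjoint operator. For a $p$ times differentiable $f$, $\nabla^m f(x)(h)^m=\sum_{i_1,\dots,i_m=1}^d\partial_{x_{i_1}\cdots x_{i_m}}f(x)\prod_{j=1}^m h_{i_j}$. A function $f$ is strongly smooth of order $p$ (integer $p>1$) with constants $0<L_1,\dots,L_p<\infty$ if for $m=1,\dots,p-1$ and all $x$, $|\nabla^m f(x)(B^{-1}\nabla f(x))^m|\le L_m\|\nabla f(x)\|_\ast^{m+\frac{p-m}{p-1}}$, and moreover $|\nabla^p f(x)(v)^p|\le L_p\|v\|^p$ for all $x,v\in\mathcal X$. If $\nabla f(x_k)=0$, the rescaled gradient step is $x_{k+1}=x_k$. $f$ is $\mu$-uniformly convex of order $p$ if $f(x)-f(y)-\langle\nabla f(y),x-y\rangle\ge\frac{\mu}{p}\|x-y\|^p$ for all $x,y\in\mathcal X$. If $E_0=0$, the bound in (2) is read as $0$. *)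

theory Defs
  imports "HOL-Analysis.Analysis" "HOL-Library.Landau_Symbols"
begin

text \<open>
  The space and its dual are both modelled by one Euclidean space, the duality pairing being
  the inner product; \<open>B\<close> is then an operator on that space and gradients are vectors.
\<close>

definition pos_def_self_adjoint :: "('a::euclidean_space \<Rightarrow> 'a) \<Rightarrow> bool" where
  "pos_def_self_adjoint B \<longleftrightarrow>
     linear B \<and> (\<forall>v w. v \<bullet> B w = B v \<bullet> w) \<and> (\<forall>v. v \<noteq> 0 \<longrightarrow> 0 < v \<bullet> B v)"

definition primal_norm :: "('a::euclidean_space \<Rightarrow> 'a) \<Rightarrow> 'a \<Rightarrow> real" where
  "primal_norm B v = sqrt (v \<bullet> B v)"

definition dual_norm :: "('a::euclidean_space \<Rightarrow> 'a) \<Rightarrow> 'a \<Rightarrow> real" where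
  "dual_norm B s = sqrt (s \<bullet> inv B s)"

definition gradient :: "('a::euclidean_space \<Rightarrow> real) \<Rightarrow> 'a \<Rightarrow> 'a" where
  "gradient f x = (THE g. GDERIV f x :> g)"

definition partial_deriv :: "'a::euclidean_space \<Rightarrow> ('a \<Rightarrow> real) \<Rightarrow> 'a \<Rightarrow> real" where
  "partial_deriv b f x = deriv (\<lambda>t. f (x + t *\<^sub>R b)) 0"

primrec iter_partial :: "'a::euclidean_space list \<Rightarrow> ('a \<Rightarrow> real) \<Rightarrow> 'a \<Rightarrow> real" where
  "iter_partial [] f = f"
| "iter_partial (b # bs) f = partial_deriv b (iter_partial bs f)"

text \<open>
  Differentiability is total (Frechet) differentiability: every partial derivative of order
  less than \<open>p\<close> is required to be differentiable, not merely partially differentiable.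
\<close>

definition times_differentiable :: "nat \<Rightarrow> ('a::euclidean_space \<Rightarrow> real) \<Rightarrow> bool" where
  "times_differentiable p f \<longleftrightarrow>
     (\<forall>bs. set bs \<subseteq> Basis \<and> length bs < p \<longrightarrow> iter_partial bs f differentiable_on UNIV)"

text \<open>
  A list \<open>bs\<close> of \<open>m\<close> basis vectors stands for a multi-index \<open>(i\<^sub>1, \<dots>, i\<^sub>m)\<close>.
\<close>

definition nabla_pow :: "nat \<Rightarrow> ('a::euclidean_space \<Rightarrow> real) \<Rightarrow> 'a \<Rightarrow> 'a \<Rightarrow> real" where
  "nabla_pow m f x h =
     (\<Sum>bs \<in> {bs. set bs \<subseteq> Basis \<and> length bs = m}.
        iter_partial bs f x * (\<Prod>j<m. h \<bullet> (bs ! j)))"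

definition strongly_smooth ::
  "('a::euclidean_space \<Rightarrow> 'a) \<Rightarrow> nat \<Rightarrow> (nat \<Rightarrow> real) \<Rightarrow> ('a \<Rightarrow> real) \<Rightarrow> bool" where
  "strongly_smooth B p L f \<longleftrightarrow>
     (\<forall>m\<in>{1..p}. 0 < L m) \<and>
     times_differentiable p f \<and>
     (\<forall>m\<in>{1..p - 1}. \<forall>x.
        \<bar>nabla_pow m f x (inv B (gradient f x))\<bar>
          \<le> L m * dual_norm B (gradient f x) powr (real m + (real p - real m) / (real p - 1))) \<and>
     (\<forall>x v. \<bar>nabla_pow p f x v\<bar> \<le> L p * primal_norm B v ^ p)"

definition uniformly_convex ::
  "('a::euclidean_space \<Rightarrow> 'a) \<Rightarrow> nat \<Rightarrow> real \<Rightarrow> ('a \<Rightarrow> real) \<Rightarrow> bool" where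
  "uniformly_convex B p \<mu> f \<longleftrightarrow>
     (\<forall>x y. f x - f y - gradient f y \<bullet> (x - y) \<ge> \<mu> / real p * primal_norm B (x - y) ^ p)"

definition rescaled_gradient_step ::
  "('a::euclidean_space \<Rightarrow> 'a) \<Rightarrow> nat \<Rightarrow> real \<Rightarrow> ('a \<Rightarrow> real) \<Rightarrow> 'a \<Rightarrow> 'a" where
  "rescaled_gradient_step B p \<eta> f x =
     (if gradient f x = 0 then x
      else x - (\<eta> powr (1 / (real p - 1))
                 / dual_norm B (gradient f x) powr ((real p - 2) / (real p - 1)))
               *\<^sub>R inv B (gradient f x))"

definition convex_const :: "nat \<Rightarrow> real" where
  "convex_const p = (1 - 1 / real p) ^ p / (real p - 1)"

text \<open>
  For \<open>E = 0\<close> the power \<open>E\<close> to the \<open>-1/p\<close> is infinite, so the bound is read as \<open>0\<close>.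
\<close>

definition convex_bound :: "nat \<Rightarrow> real \<Rightarrow> real \<Rightarrow> real \<Rightarrow> nat \<Rightarrow> real" where
  "convex_bound p E R \<delta> k =
     (if E = 0 then 0
      else 2 * (1 / E powr (1 / real p)
                + 1 / (R * convex_const p powr (1 / real p) * real p)
                  * (\<delta> * real k) powr ((real p - 1) / real p)) powr (- real p))"

definition convex_rate :: "nat \<Rightarrow> real \<Rightarrow> real \<Rightarrow> nat \<Rightarrow> real" where
  "convex_rate p R \<delta> k =
     1 / (1 + 1 / (R * real p) * (\<delta> * real k) powr ((real p - 1) / real p)) ^ p"

end

theory Submission
  imports Defs
begin

text \<open>
  Expanding \<open>f\<close> to order \<open>p\<close> along one step, every term of order \<open>m \<ge> 2\<close> is at most
  \<open>\<eta>\<^bsup>2/(p-1)\<^esup> L\<^sub>m/m!\<close> times \<open>\<parallel>\<nabla>f\<parallel>\<^bsup>p/(p-1)\<^esup>\<close>, because the exponents in strong smoothness are matched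
  to the rescaling. The step size condition lets the first-order term absorb half of itself, so
  that \<open>f\<close> decreases by at least \<open>\<delta> \<parallel>\<nabla>f\<parallel>\<^bsup>p/(p-1)\<^esup>\<close>. Summing these decreases bounds the smallest
  gradient. If \<open>f\<close> is convex, the gap \<open>E\<close> satisfies \<open>E \<le> R \<parallel>\<nabla>f\<parallel>\<close>, so \<open>E\<^bsup>-1/(p-1)\<^esup>\<close> grows linearly in
  \<open>k\<close>; the factor 2 in the bound comes from a power mean inequality that separates the two
  summands. If \<open>f\<close> is uniformly convex, Young's inequality bounds the gap by a multiple of
  \<open>\<parallel>\<nabla>f\<parallel>\<^bsup>p/(p-1)\<^esup>\<close>, which makes the decrease geometric.
\<close>

section \<open>Higher derivatives along a line\<close>

lemma has_real_derivative_along_line: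
  fixes F :: "'a::euclidean_space \<Rightarrow> real"
  assumes "(F has_derivative D) (at (x + t *\<^sub>R h))"
  shows "((\<lambda>s. F (x + s *\<^sub>R h)) has_real_derivative D h) (at t)"
proof -
  have "((\<lambda>s. x + s *\<^sub>R h) has_derivative (\<lambda>s. s *\<^sub>R h)) (at t)"
    by (auto intro!: derivative_eq_intros)
  from has_derivative_compose[OF this assms]
  have "((\<lambda>s. F (x + s *\<^sub>R h)) has_derivative (\<lambda>s. D (s *\<^sub>R h))) (at t)" .
  moreover have "(\<lambda>s. D (s *\<^sub>R h)) = (*) (D h)"
    using has_derivative_linear[OF assms] by (auto simp: linear_cmul)
  ultimately show ?thesis
    by (simp add: has_field_derivative_def)
qed

lemma partial_deriv_eq:
  assumes "(F has_derivative D) (at x)"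
  shows "partial_deriv b F x = D b"
  unfolding partial_deriv_def
  by (rule DERIV_imp_deriv, rule has_real_derivative_along_line) (use assms in simp)

lemma has_derivative_eq_sum_partial_deriv:
  fixes F :: "'a::euclidean_space \<Rightarrow> real"
  assumes "(F has_derivative D) (at x)"
  shows "D h = (\<Sum>b\<in>Basis. (h \<bullet> b) * partial_deriv b F x)"
proof -
  have "linear D" using assms by (rule has_derivative_linear)
  then have "D (\<Sum>b\<in>Basis. (h \<bullet> b) *\<^sub>R b) = (\<Sum>b\<in>Basis. (h \<bullet> b) * D b)"
    by (simp add: linear_sum linear_cmul)
  then show ?thesis
    using partial_deriv_eq[OF assms] by (simp add: euclidean_representation)
qed

text \<open>Splits off the head of each multi-index. \<open>iter_partial\<close> applies the head
  last, so summing over it gives the directional derivative along \<open>h\<close> of the partial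
  derivative belonging to the tail.\<close>

lemma nabla_pow_Suc:
  "nabla_pow (Suc m) f x h =
     (\<Sum>bs \<in> {bs. set bs \<subseteq> Basis \<and> length bs = m}.
        (\<Sum>b\<in>Basis. (h \<bullet> b) * partial_deriv b (iter_partial bs f) x) * (\<Prod>j<m. h \<bullet> (bs ! j)))"
proof -
  let ?S = "{bs. set bs \<subseteq> (Basis :: 'a set) \<and> length bs = m}"
  have bij: "bij_betw (\<lambda>(bs, b). b # bs) (?S \<times> Basis)
              {bs. set bs \<subseteq> (Basis :: 'a set) \<and> length bs = Suc m}"
    unfolding bij_betw_def inj_on_def by (auto simp: length_Suc_conv image_iff)
  have "nabla_pow (Suc m) f x h =
      (\<Sum>(bs, b)\<in>?S \<times> Basis. iter_partial (b # bs) f x * (\<Prod>j<Suc m. h \<bullet> ((b # bs) ! j)))"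
    unfolding nabla_pow_def
    by (subst sum.reindex_bij_betw[OF bij, symmetric]) (simp add: case_prod_unfold)
  also have "\<dots> = (\<Sum>bs\<in>?S. \<Sum>b\<in>Basis.
      iter_partial (b # bs) f x * (\<Prod>j<Suc m. h \<bullet> ((b # bs) ! j)))"
    by (simp add: sum.cartesian_product)
  finally show ?thesis
    by (simp add: prod.lessThan_Suc_shift sum_distrib_left sum_distrib_right mult_ac
        del: prod.lessThan_Suc)
qed

lemma nabla_pow_0: "nabla_pow 0 f x h = f x"
  by (simp add: nabla_pow_def cong: conj_cong)

lemma nabla_pow_scaleR: "nabla_pow m f x (c *\<^sub>R h) = c ^ m * nabla_pow m f x h"
  by (simp add: nabla_pow_def prod.distrib sum_distrib_left mult_ac)

text \<open>Makes \<open>nabla_pow m f\<close> the \<open>m\<close>-th derivative of the restriction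
  of \<open>f\<close> to a line. Total differentiability of the partials of order
  \<open>m < p\<close> turns the sum over the new index into a derivative along
  \<open>h\<close>.\<close>

lemma nabla_pow_along_line:
  assumes "times_differentiable p f" "m < p"
  shows "((\<lambda>t. nabla_pow m f (x + t *\<^sub>R h) h) has_real_derivative
           nabla_pow (Suc m) f (x + t *\<^sub>R h) h) (at t)"
proof -
  have "((\<lambda>t. iter_partial bs f (x + t *\<^sub>R h)) has_real_derivative
      (\<Sum>b\<in>Basis. (h \<bullet> b) * partial_deriv b (iter_partial bs f) (x + t *\<^sub>R h))) (at t)"
    if "set bs \<subseteq> Basis" "length bs = m" for bs
  proof -
    have "iter_partial bs f differentiable (at (x + t *\<^sub>R h))"
      using assms that by (auto simp: times_differentiable_def differentiable_on_def)
    then obtain D where D: "(iter_partial bs f has_derivative D) (at (x + t *\<^sub>R h))"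
      by (auto simp: differentiable_def)
    from has_real_derivative_along_line[OF D] show ?thesis
      by (simp only: has_derivative_eq_sum_partial_deriv[OF D])
  qed
  then show ?thesis
    unfolding nabla_pow_Suc unfolding nabla_pow_def
    by (intro DERIV_sum DERIV_cmult_right) auto
qed

text \<open>Maclaurin's formula with Lagrange remainder for \<open>f (x + t *\<^sub>R h)\<close> as
  a function of \<open>t\<close>, taken at \<open>t = 1\<close>.\<close>

lemma taylor_nabla_pow:
  assumes "times_differentiable p f" "p > 0"
  obtains \<xi> where
    "f (x + h) = (\<Sum>m<p. nabla_pow m f x h / fact m) + nabla_pow p f \<xi> h / fact p"
proof -
  have "\<exists>t::real. 0 < t \<and> t < 1 \<and> f (x + 1 *\<^sub>R h) =
      (\<Sum>m<p. nabla_pow m f (x + 0 *\<^sub>R h) h / fact m * 1 ^ m)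
        + nabla_pow p f (x + t *\<^sub>R h) h / fact p * 1 ^ p"
    by (rule Maclaurin[where diff = "\<lambda>m t. nabla_pow m f (x + t *\<^sub>R h) h"])
      (use assms nabla_pow_along_line in \<open>auto simp: nabla_pow_0\<close>)
  then show thesis using that by auto
qed

text \<open>\<open>gradient\<close> is a definite description. The vector of partial derivatives
  gives existence, and uniqueness of the Frechet derivative gives uniqueness.\<close>

lemma GDERIV_gradient:
  fixes f :: "'a::euclidean_space \<Rightarrow> real"
  assumes "f differentiable (at x)"
  shows "GDERIV f x :> gradient f x"
proof -
  obtain D where D: "(f has_derivative D) (at x)"
    using assms by (auto simp: differentiable_def)
  have "D = (\<lambda>h. h \<bullet> (\<Sum>b\<in>Basis. partial_deriv b f x *\<^sub>R b))"
    using has_derivative_eq_sum_partial_deriv[OF D]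
    by (auto simp: inner_sum_right mult_ac)
  with D have ex: "GDERIV f x :> (\<Sum>b\<in>Basis. partial_deriv b f x *\<^sub>R b)"
    by (simp add: gderiv_def inner_commute)
  have "g = g'" if "GDERIV f x :> g" "GDERIV f x :> g'" for g g'
  proof -
    have "(\<lambda>h. h \<bullet> g) = (\<lambda>h. h \<bullet> g')"
      using that unfolding gderiv_def by (rule has_derivative_unique)
    then show ?thesis by (metis vector_eq_ldot)
  qed
  with ex show ?thesis unfolding gradient_def by (metis theI)
qed

lemma gradient_along_line:
  fixes f :: "'a::euclidean_space \<Rightarrow> real"
  assumes "f differentiable (at (x + t *\<^sub>R h))"
  shows "((\<lambda>s. f (x + s *\<^sub>R h)) has_real_derivative gradient f (x + t *\<^sub>R h) \<bullet> h) (at t)"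
  using has_real_derivative_along_line[OF GDERIV_gradient[OF assms, unfolded gderiv_def]]
  by (simp add: inner_commute)

lemma nabla_pow_1:
  assumes "times_differentiable p f" "p > 0"
  shows "nabla_pow 1 f x h = gradient f x \<bullet> h"
proof (rule DERIV_unique)
  show "((\<lambda>t. f (x + t *\<^sub>R h)) has_real_derivative nabla_pow 1 f x h) (at 0)"
    using nabla_pow_along_line[OF assms, of x h 0] by (simp add: nabla_pow_0)
  have "f differentiable (at x)"
    using assms unfolding times_differentiable_def differentiable_on_def
    by (auto dest!: spec[of _ "[]"])
  then show "((\<lambda>t. f (x + t *\<^sub>R h)) has_real_derivative gradient f x \<bullet> h) (at 0)"
    using gradient_along_line[of f x 0 h] by simp
qed

text \<open>Reduces to the one-dimensional tangent inequality on the line through \<open>y\<close>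
  and \<open>z\<close>.\<close>

lemma convex_on_above_gradient:
  fixes f :: "'a::euclidean_space \<Rightarrow> real"
  assumes "convex_on UNIV f" "f differentiable (at y)"
  shows "f y + gradient f y \<bullet> (z - y) \<le> f z"
proof -
  let ?\<phi> = "\<lambda>t. f (y + t *\<^sub>R (z - y))"
  have "convex_on UNIV ?\<phi>"
  proof (rule convex_onI)
    fix t a b :: real assume "0 < t" "t < 1"
    moreover have "y + ((1 - t) *\<^sub>R a + t *\<^sub>R b) *\<^sub>R (z - y) =
        (1 - t) *\<^sub>R (y + a *\<^sub>R (z - y)) + t *\<^sub>R (y + b *\<^sub>R (z - y))"
      by (simp add: algebra_simps)
    ultimately show "?\<phi> ((1 - t) *\<^sub>R a + t *\<^sub>R b) \<le> (1 - t) * ?\<phi> a + t * ?\<phi> b"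
      using convex_onD[OF assms(1)] by simp
  qed simp
  then have "?\<phi> 1 - ?\<phi> 0 \<ge> (gradient f y \<bullet> (z - y)) * (1 - 0)"
    by (rule convex_on_imp_above_tangent)
      (use gradient_along_line[of f y 0 "z - y"] assms(2) in \<open>auto intro: DERIV_subset\<close>)
  then show ?thesis by simp
qed

section \<open>The norm of a positive definite operator and its dual\<close>

lemma pos_def_bij:
  assumes "pos_def_self_adjoint B"
  shows "bij B"
proof -
  have lin: "linear B" using assms by (simp add: pos_def_self_adjoint_def)
  have "v = 0" if "B v = 0" for v
    using assms that by (force simp: pos_def_self_adjoint_def)
  then have "inj B" using linear_injective_0[OF lin] by blast
  then show ?thesis
    using linear_injective_imp_surjective[OF lin] by (simp add: bij_def)
qed

lemma pos_def_apply_inv: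
  assumes "pos_def_self_adjoint B"
  shows "B (inv B s) = s"
  using pos_def_bij[OF assms] by (simp add: bij_is_surj surj_f_inv_f)

lemma pos_def_nonneg:
  assumes "pos_def_self_adjoint B"
  shows "0 \<le> v \<bullet> B v"
  using assms by (cases "v = 0") (auto simp: pos_def_self_adjoint_def less_imp_le)

lemma primal_norm_nonneg: "pos_def_self_adjoint B \<Longrightarrow> 0 \<le> primal_norm B v"
  by (simp add: primal_norm_def pos_def_nonneg)

lemma primal_norm_pos: "pos_def_self_adjoint B \<Longrightarrow> v \<noteq> 0 \<Longrightarrow> 0 < primal_norm B v"
  by (auto simp: primal_norm_def pos_def_self_adjoint_def inner_commute)

lemma primal_norm_scaleR:
  assumes "pos_def_self_adjoint B"
  shows "primal_norm B (c *\<^sub>R v) = \<bar>c\<bar> * primal_norm B v"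
proof -
  have "linear B" using assms by (simp add: pos_def_self_adjoint_def)
  then have "(c *\<^sub>R v) \<bullet> B (c *\<^sub>R v) = c\<^sup>2 * (v \<bullet> B v)"
    by (simp add: linear_cmul power2_eq_square)
  then show ?thesis by (simp add: primal_norm_def real_sqrt_mult)
qed

text \<open>\<open>inv B\<close> is the Riesz isometry from the dual space to the primal one, which
  lets facts about the dual norm follow from those about the primal norm.\<close>

lemma primal_norm_inv:
  assumes "pos_def_self_adjoint B"
  shows "primal_norm B (inv B s) = dual_norm B s"
  by (simp add: primal_norm_def dual_norm_def pos_def_apply_inv[OF assms] inner_commute)

lemma dual_norm_nonneg: "pos_def_self_adjoint B \<Longrightarrow> 0 \<le> dual_norm B s"
  by (simp flip: primal_norm_inv add: primal_norm_nonneg)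

lemma dual_norm_0: "dual_norm B 0 = 0"
  by (simp add: dual_norm_def)

lemma dual_norm_pos:
  assumes "pos_def_self_adjoint B" "s \<noteq> 0"
  shows "0 < dual_norm B s"
proof -
  have "linear B" using assms by (simp add: pos_def_self_adjoint_def)
  then have "inv B s \<noteq> 0"
    using pos_def_apply_inv[OF assms(1), of s] assms(2) linear_0 by force
  then show ?thesis
    using primal_norm_pos[OF assms(1)] primal_norm_inv[OF assms(1)] by metis
qed

lemma dual_norm_sq:
  assumes "pos_def_self_adjoint B"
  shows "s \<bullet> inv B s = (dual_norm B s)\<^sup>2"
  using pos_def_nonneg[OF assms, of "inv B s"]
  by (simp add: dual_norm_def pos_def_apply_inv[OF assms] inner_commute)

text \<open>Cauchy-Schwarz for the inner product induced by \<open>B\<close>, applied to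
  \<open>inv B s\<close> and \<open>v\<close>.\<close>

lemma inner_le_dual_primal:
  assumes B: "pos_def_self_adjoint B"
  shows "\<bar>s \<bullet> v\<bar> \<le> dual_norm B s * primal_norm B v"
proof (cases "s = 0")
  case False
  define w where "w = inv B s"
  define n where "n = dual_norm B s"
  have n: "n > 0" using dual_norm_pos[OF B False] by (simp add: n_def)
  have lin: "linear B" and adj: "\<And>u v. u \<bullet> B v = B u \<bullet> v"
    using B by (auto simp: pos_def_self_adjoint_def)
  have Bw: "B w = s" by (simp add: w_def pos_def_apply_inv[OF B])
  have ww: "w \<bullet> s = n\<^sup>2" using dual_norm_sq[OF B, of s] by (simp add: w_def n_def inner_commute)
  \<comment> \<open>\<open>c *\<^sub>R w\<close> is the \<open>B\<close>-orthogonal projection of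
    \<open>v\<close> onto the line spanned by \<open>w\<close>; the residual has nonnegative squared
    norm.\<close>
  define c where "c = (s \<bullet> v) / n\<^sup>2"
  have "0 \<le> (v - c *\<^sub>R w) \<bullet> B (v - c *\<^sub>R w)" by (rule pos_def_nonneg[OF B])
  also have "\<dots> = v \<bullet> B v - 2 * c * (s \<bullet> v) + c\<^sup>2 * n\<^sup>2"
    using adj[of w v]
    by (simp add: linear_diff[OF lin] linear_cmul[OF lin] Bw inner_diff_left inner_diff_right ww
        inner_commute[of v s] power2_eq_square[of c] algebra_simps)
  also have "\<dots> = v \<bullet> B v - (s \<bullet> v)\<^sup>2 / n\<^sup>2"
    using n by (simp add: c_def power2_eq_square field_simps)
  finally have "(s \<bullet> v)\<^sup>2 \<le> n\<^sup>2 * (v \<bullet> B v)"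
    using n by (simp add: field_simps)
  then have "sqrt ((s \<bullet> v)\<^sup>2) \<le> sqrt (n\<^sup>2 * (v \<bullet> B v))"
    by (rule real_sqrt_le_mono)
  then show ?thesis using n by (simp add: real_sqrt_mult primal_norm_def n_def)
qed (simp add: dual_norm_0)

section \<open>Decrease along one rescaled gradient step\<close>

text \<open>The rescaling subtracts \<open>m * (p - 2) / (p - 1)\<close> from the strong smoothness
  exponent, which leaves \<open>p / (p - 1)\<close> for every order \<open>m\<close>.\<close>

lemma rescaled_power_identity:
  fixes n \<epsilon> :: real
  assumes "n > 0" "p > 1"
  shows "(\<epsilon> / n powr ((real p - 2) / (real p - 1))) ^ m
           * n powr (real m + (real p - real m) / (real p - 1))
         = \<epsilon> ^ m * n powr (real p / (real p - 1))"
proof -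
  define a where "a = (real p - 2) / (real p - 1)"
  have "(n powr a) ^ m = n powr (a * real m)"
    using assms by (simp add: powr_powr flip: powr_realpow)
  moreover have "real m + (real p - real m) / (real p - 1) - a * real m = real p / (real p - 1)"
    using assms by (simp add: a_def divide_simps) (simp add: algebra_simps)
  ultimately have "n powr (real m + (real p - real m) / (real p - 1)) / (n powr a) ^ m
      = n powr (real p / (real p - 1))"
    by (simp flip: powr_diff)
  then show ?thesis
    unfolding a_def by (simp add: power_divide flip: times_divide_eq_right)
qed

text \<open>In the Taylor expansion along the step, the first-order term is
  \<open>- \<epsilon> * N\<close> and all later terms together are at most
  \<open>\<epsilon>\<^sup>2 * S * N\<close>, hence at most half of
  \<open>\<epsilon> * N\<close>.\<close>

lemma rescaled_gradient_step_decrease: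
  assumes B: "pos_def_self_adjoint B"
    and p: "p > 1"
    and smooth: "strongly_smooth B p L f"
    and \<eta>: "\<eta> > 0"
    and step: "\<eta> powr (1 / (real p - 1)) \<le> min 1 (1 / (2 * (\<Sum>m = 2..p. L m / fact m)))"
    and \<delta>: "\<delta> > 0" "\<delta> ^ (p - 1) = \<eta> / 2 ^ (p - 1)"
  shows "f (rescaled_gradient_step B p \<eta> f y)
           \<le> f y - \<delta> * dual_norm B (gradient f y) powr (real p / (real p - 1))"
proof (cases "gradient f y = 0")
  case True
  then show ?thesis by (simp add: rescaled_gradient_step_def dual_norm_0)
next
  case False
  define g where "g = gradient f y"
  define n where "n = dual_norm B g"
  define \<epsilon> where "\<epsilon> = \<eta> powr (1 / (real p - 1))"
  define t where "t = \<epsilon> / n powr ((real p - 2) / (real p - 1))"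
  define S where "S = (\<Sum>m = 2..p. L m / fact m)"
  define N where "N = n powr (real p / (real p - 1))"
  have n: "n > 0" using dual_norm_pos[OF B False] by (simp add: n_def g_def)
  have \<epsilon>: "\<epsilon> > 0" "\<epsilon> \<le> 1" using \<eta> step by (auto simp: \<epsilon>_def)
  have t: "t > 0" using \<epsilon> n by (simp add: t_def)
  have N: "N > 0" using n by (simp add: N_def)
  have diff: "times_differentiable p f" and L: "\<And>m. m \<in> {1..p} \<Longrightarrow> 0 < L m"
    and low: "\<And>m. m \<in> {1..p - 1} \<Longrightarrow> \<bar>nabla_pow m f y (inv B g)\<bar>
          \<le> L m * n powr (real m + (real p - real m) / (real p - 1))"
    and top: "\<And>x v. \<bar>nabla_pow p f x v\<bar> \<le> L p * primal_norm B v ^ p"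
    using smooth by (auto simp: strongly_smooth_def n_def g_def)
  have S: "S > 0"
    unfolding S_def using p L by (intro sum_pos) auto
  \<comment> \<open>Both sides are positive with the same power \<open>p - 1\<close>.\<close>
  have \<delta>_eq: "\<delta> = \<epsilon> / 2"
  proof -
    have "\<epsilon> ^ (p - 1) = \<eta>"
      using \<eta> p by (simp add: \<epsilon>_def powr_powr of_nat_diff flip: powr_realpow)
    then have "\<delta> ^ (p - 1) = (\<epsilon> / 2) ^ (p - 1)"
      using \<delta> by (simp add: power_divide)
    then show ?thesis
      by (rule power_eq_imp_eq_base) (use \<delta>(1) \<epsilon>(1) p in auto)
  qed
  have ident: "t ^ m * n powr (real m + (real p - real m) / (real p - 1)) = \<epsilon> ^ m * N" for m
    unfolding t_def N_def by (rule rescaled_power_identity[OF n p])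
  \<comment> \<open>Here \<open>\<epsilon> \<le> 1\<close> enters: every order from 2 on is
    dominated by the quadratic one.\<close>
  have pow: "c * (\<epsilon> ^ m * N) \<le> c * (\<epsilon>\<^sup>2 * N)" if "2 \<le> m" "0 < c" for m c
    using that \<epsilon> N by (intro mult_left_mono mult_right_mono power_decreasing) auto
  define h where "h = (- t) *\<^sub>R inv B g"
  have bound: "nabla_pow m f y h \<le> L m * (\<epsilon>\<^sup>2 * N)" if "m \<in> {2..<p}" for m
  proof -
    have "nabla_pow m f y h \<le> \<bar>nabla_pow m f y h\<bar>" by simp
    also have "\<dots> = t ^ m * \<bar>nabla_pow m f y (inv B g)\<bar>"
      using t by (simp add: h_def nabla_pow_scaleR abs_mult power_abs del: scaleR_minus_left)
    also have "\<dots> \<le> t ^ m * (L m * n powr (real m + (real p - real m) / (real p - 1)))"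
      using t that by (intro mult_left_mono low) auto
    also have "\<dots> = L m * (\<epsilon> ^ m * N)"
      by (simp flip: ident)
    also have "\<dots> \<le> L m * (\<epsilon>\<^sup>2 * N)"
      using that L by (intro pow) auto
    finally show ?thesis .
  qed
  \<comment> \<open>The remainder is evaluated at an unknown point, so the global bound on order
    \<open>p\<close> is used. At \<open>m = p\<close> the strong smoothness exponent is
    \<open>p\<close>, and the same identity applies.\<close>
  have bound_top: "nabla_pow p f x h \<le> L p * (\<epsilon>\<^sup>2 * N)" for x
  proof -
    have "nabla_pow p f x h \<le> L p * primal_norm B h ^ p"
      using top abs_le_D1 by blast
    also have "primal_norm B h = t * n"
      using t unfolding h_def primal_norm_scaleR[OF B] primal_norm_inv[OF B] n_def by simp
    also have "(t * n) ^ p = \<epsilon> ^ p * N"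
      using ident[of p] n by (simp add: power_mult_distrib powr_realpow)
    also have "L p * (\<epsilon> ^ p * N) \<le> L p * (\<epsilon>\<^sup>2 * N)"
      using p L by (intro pow) auto
    finally show ?thesis .
  qed
  have first: "nabla_pow 1 f y h = - \<epsilon> * N"
  proof -
    have "nabla_pow 1 f y h = - t * n\<^sup>2"
      using nabla_pow_1[OF diff] p dual_norm_sq[OF B, of g] by (simp add: h_def n_def g_def)
    moreover have "real 1 + (real p - real 1) / (real p - 1) = 2" using p by simp
    ultimately show ?thesis
      using ident[of 1] n by (simp add: powr_numeral)
  qed
  obtain \<xi> where "f (y + h) = (\<Sum>m<p. nabla_pow m f y h / fact m) + nabla_pow p f \<xi> h / fact p"
    using taylor_nabla_pow[OF diff] p by auto
  also have "{..<p} = {0, 1} \<union> {2..<p}" using p by auto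
  also have "(\<Sum>m\<in>{0, 1} \<union> {2..<p}. nabla_pow m f y h / fact m)
      = f y - \<epsilon> * N + (\<Sum>m\<in>{2..<p}. nabla_pow m f y h / fact m)"
    using first by (subst sum.union_disjoint) (auto simp: nabla_pow_0)
  also have "(\<Sum>m\<in>{2..<p}. nabla_pow m f y h / fact m) \<le> (\<Sum>m\<in>{2..<p}. L m * (\<epsilon>\<^sup>2 * N) / fact m)"
    by (intro sum_mono divide_right_mono bound) auto
  also have "nabla_pow p f \<xi> h / fact p \<le> L p * (\<epsilon>\<^sup>2 * N) / fact p"
    by (intro divide_right_mono bound_top) auto
  also have "f y - \<epsilon> * N + (\<Sum>m\<in>{2..<p}. L m * (\<epsilon>\<^sup>2 * N) / fact m) + L p * (\<epsilon>\<^sup>2 * N) / fact p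
      = f y - \<epsilon> * N + \<epsilon> * (\<epsilon> * S) * N"
  proof -
    have "{2..p} = insert p {2..<p}" using p by auto
    then show ?thesis
      by (simp add: S_def power2_eq_square sum_distrib_left sum_distrib_right algebra_simps)
  qed
  \<comment> \<open>The step size condition says \<open>\<epsilon> * S \<le> 1 / 2\<close>.\<close>
  also have "\<dots> \<le> f y - \<epsilon> * N + \<epsilon> * (1 / 2) * N"
    using step S \<epsilon> N
    by (intro add_left_mono mult_right_mono mult_left_mono)
      (auto simp: field_simps simp flip: \<epsilon>_def S_def)
  finally have "f (y + h) \<le> f y - \<delta> * N"
    by (simp add: \<delta>_eq mult.commute)
  moreover have "rescaled_gradient_step B p \<eta> f y = y + h"
    using False by (simp add: rescaled_gradient_step_def h_def t_def \<epsilon>_def n_def g_def)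
  ultimately show ?thesis
    by (simp add: N_def n_def g_def)
qed

section \<open>Recurrences\<close>

text \<open>Midpoint convexity of the power \<open>s = (r + 1) / r\<close>, applied to
  \<open>u\<close> and \<open>v\<close> and then raised to the power \<open>r\<close>. The factor 2
  is the quotient of \<open>2 powr (r + 1)\<close> and \<open>2 powr r\<close>.\<close>

lemma powr_add_le_two_powr:
  fixes A C r :: real
  assumes "A \<ge> 0" "C \<ge> 0" "r > 0"
  shows "(A powr (r / (r + 1)) + C powr (r / (r + 1))) powr (r + 1) \<le> 2 * (A + C) powr r"
proof (cases "A = 0 \<or> C = 0")
  case True
  moreover have "r / (r + 1) * (r + 1) = r" using assms by simp
  ultimately show ?thesis using assms by (auto simp: powr_powr simp del: times_divide_eq_left)
next
  case False
  define u where "u = A powr (r / (r + 1))"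
  define v where "v = C powr (r / (r + 1))"
  define s where "s = (r + 1) / r"
  have uv: "u > 0" "v > 0" using False assms by (auto simp: u_def v_def)
  have s: "s \<ge> 1" "s * r = r + 1" using assms by (auto simp: s_def field_simps)
  have us: "u powr s = A" "v powr s = C"
    using assms False by (auto simp: u_def v_def s_def powr_powr)
  have "((1 - 1/2) *\<^sub>R u + (1/2) *\<^sub>R v) powr s \<le> (1 - 1/2) * u powr s + (1/2) * v powr s"
    by (rule convex_onD[OF powr_convex]) (use uv s in auto)
  then have "((u + v) / 2) powr s \<le> (A + C) / 2"
    by (simp add: us field_simps)
  then have "(((u + v) / 2) powr s) powr r \<le> ((A + C) / 2) powr r"
    using assms by (intro powr_mono2) auto
  then have "(u + v) powr (r + 1) / 2 powr (r + 1) \<le> (A + C) powr r / 2 powr r"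
    using uv assms by (simp add: powr_powr s powr_divide)
  then have "(u + v) powr (r + 1) \<le> 2 * (A + C) powr r"
    by (simp add: powr_add[of 2] divide_simps split: if_splits)
  then show ?thesis by (simp add: u_def v_def)
qed

text \<open>The sequence \<open>E\<^sub>k\<close> to the power \<open>-1/r\<close> grows by at least \<open>a/r\<close> in each step.\<close>

lemma powr_recurrence_bound:
  fixes E :: "nat \<Rightarrow> real"
  assumes nonneg: "\<And>k. 0 \<le> E k" and a: "0 \<le> a" and r: "0 < r"
    and rec: "\<And>k. E (Suc k) \<le> E k - a * E k powr ((r + 1) / r)"
    and "0 < E 0"
  shows "E k \<le> (E 0 powr (- 1 / r) + a * real k / r) powr (- r)"
proof (cases "E k = 0")
  case False
  \<comment> \<open>Positivity is a premise because \<open>0 powr (- 1 / r)\<close> is 0 instead of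
    infinite. It passes from \<open>E (Suc k)\<close> back to \<open>E k\<close>, since the sequence
    is nonincreasing.\<close>
  have grow: "0 < E k \<Longrightarrow> E 0 powr (- 1 / r) + a * real k / r \<le> E k powr (- 1 / r)" for k
  proof (induction k)
    case (Suc k)
    have "0 \<le> a * E k powr ((r + 1) / r)" using a by simp
    then have pos: "0 < E k" using rec[of k] Suc.prems by linarith
    define z where "z = a * E k powr (1 / r)"
    have "(r + 1) / r = 1 + 1 / r" using r by (simp add: field_simps)
    then have le: "E (Suc k) \<le> E k * (1 - z)"
      using rec[of k] pos by (simp add: z_def powr_add algebra_simps)
    then have z: "0 < 1 - z" using Suc.prems pos by (smt (verit) zero_less_mult_pos)
    \<comment> \<open>A Bernoulli inequality for the exponent \<open>- 1 / r\<close>, obtained from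
      \<open>ln (1 - z) \<le> - z\<close>.\<close>
    have "1 + z / r \<le> exp (z / r)" by (rule exp_ge_add_one_self)
    also have "\<dots> \<le> exp (- 1 / r * ln (1 - z))"
      using ln_le_minus_one[OF z] r by (simp add: field_simps)
    also have "\<dots> = (1 - z) powr (- 1 / r)" using z by (simp add: powr_def)
    finally have "E k powr (- 1 / r) * (1 + z / r) \<le> (E k * (1 - z)) powr (- 1 / r)"
      using pos z by (simp add: powr_mult mult_left_mono)
    also have "\<dots> \<le> E (Suc k) powr (- 1 / r)"
      using le Suc.prems r by (intro powr_mono2') auto
    \<comment> \<open>The factor \<open>E k powr (1 / r)\<close> in \<open>z\<close> cancels, so the
      increment does not depend on \<open>k\<close>.\<close>
    also have "E k powr (- 1 / r) * (1 + z / r) = E k powr (- 1 / r) + a / r"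
      using pos by (simp add: z_def algebra_simps powr_minus field_simps flip: powr_add)
    finally show ?case
      using Suc.IH[OF pos] r by (simp add: field_simps)
  qed simp
  have pos: "0 < E k" using False nonneg[of k] by simp
  have "E k = (E k powr (- 1 / r)) powr (- r)" using pos r by (simp add: powr_powr)
  also have "\<dots> \<le> (E 0 powr (- 1 / r) + a * real k / r) powr (- r)"
    using grow[OF pos] r a \<open>0 < E 0\<close> by (intro powr_mono2') (auto intro!: add_pos_nonneg)
  finally show ?thesis .
qed simp

section \<open>The two convexity bounds on the gradient\<close>

text \<open>Young's inequality with conjugate exponents \<open>p\<close> and
  \<open>p / (p - 1)\<close>. The weight \<open>c = \<mu> powr (1 / p)\<close> makes the first term
  exactly the one in uniform convexity.\<close>

lemma young_powr:
  fixes \<mu> n d :: real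
  assumes "\<mu> > 0" "n \<ge> 0" "d \<ge> 0" "p > 1"
  shows "n * d \<le> \<mu> / real p * d ^ p
           + (real p - 1) / real p * \<mu> powr (- 1 / (real p - 1)) * n powr (real p / (real p - 1))"
proof -
  define q where "q = real p / (real p - 1)"
  define c where "c = \<mu> powr (1 / real p)"
  have c: "c > 0" using assms by (simp add: c_def)
  have q: "q > 1" "1 / real p + 1 / q = 1"
    using assms(4) by (auto simp: q_def field_simps)
  have "n * d = (c * d) * (n / c)" using c by simp
  also have "\<dots> \<le> (c * d) powr real p / real p + (n / c) powr q / q"
    using q assms c by (intro Youngs_inequality) auto
  also have "(c * d) powr real p = \<mu> * d ^ p"
    using assms c by (cases "d = 0") (auto simp: c_def powr_mult powr_powr powr_realpow)
  also have "(n / c) powr q = n powr q * \<mu> powr (- 1 / (real p - 1))"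
  proof -
    have "c powr q = \<mu> powr (1 / (real p - 1))"
      using assms(4) by (simp add: c_def powr_powr q_def)
    then show ?thesis
      using assms c by (simp add: powr_divide powr_minus_divide)
  qed
  finally show ?thesis
    using assms(4) by (simp add: q_def mult_ac)
qed

lemma convex_gap_le:
  assumes B: "pos_def_self_adjoint B" and "convex_on UNIV f" "f differentiable (at y)"
  shows "f y - f z \<le> dual_norm B (gradient f y) * primal_norm B (y - z)"
proof -
  have "f y - f z \<le> gradient f y \<bullet> (y - z)"
    using convex_on_above_gradient[OF assms(2,3), of z] by (simp add: inner_diff_right)
  also have "\<dots> \<le> dual_norm B (gradient f y) * primal_norm B (y - z)"
    using inner_le_dual_primal[OF B] abs_le_D1 by blast
  finally show ?thesis .
qed

text \<open>A gradient domination (Polyak-Lojasiewicz) inequality of order \<open>p\<close>: the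
  distance term from Young's inequality cancels the one from uniform convexity, leaving only the
  gradient.\<close>

lemma uniformly_convex_gap_le:
  assumes B: "pos_def_self_adjoint B" and p: "p > 1" and \<mu>: "\<mu> > 0"
    and uc: "uniformly_convex B p \<mu> f"
  shows "real p / (real p - 1) * \<mu> powr (1 / (real p - 1)) * (f y - f z)
           \<le> dual_norm B (gradient f y) powr (real p / (real p - 1))"
proof -
  define n where "n = dual_norm B (gradient f y)"
  define d where "d = primal_norm B (z - y)"
  have "\<mu> / real p * d ^ p \<le> f z - f y - gradient f y \<bullet> (z - y)"
    using uc by (simp add: uniformly_convex_def d_def)
  moreover have "- (gradient f y \<bullet> (z - y)) \<le> n * d"
    using inner_le_dual_primal[OF B, of "gradient f y" "z - y"] by (simp add: n_def d_def)
  moreover have "n * d \<le> \<mu> / real p * d ^ p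
           + (real p - 1) / real p * \<mu> powr (- 1 / (real p - 1)) * n powr (real p / (real p - 1))"
    using \<mu> p by (intro young_powr) (auto simp: n_def d_def dual_norm_nonneg[OF B] primal_norm_nonneg[OF B])
  ultimately have "f y - f z
      \<le> (real p - 1) / real p * \<mu> powr (- 1 / (real p - 1)) * n powr (real p / (real p - 1))"
    by linarith
  then have "real p / (real p - 1) * \<mu> powr (1 / (real p - 1)) * (f y - f z)
      \<le> real p / (real p - 1) * \<mu> powr (1 / (real p - 1)) *
        ((real p - 1) / real p * \<mu> powr (- 1 / (real p - 1)) * n powr (real p / (real p - 1)))"
    using p by (intro mult_left_mono) auto
  also have "\<dots> = (real p / (real p - 1) * ((real p - 1) / real p))
      * (\<mu> powr (1 / (real p - 1)) * \<mu> powr (- 1 / (real p - 1))) * n powr (real p / (real p - 1))"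
    by (simp only: mult_ac)
  also have "\<dots> = n powr (real p / (real p - 1))"
    using p \<mu> by (simp flip: powr_add)
  finally show ?thesis by (simp add: n_def)
qed

section \<open>The rate in the convex case\<close>

lemma convex_const_pos: "p > 1 \<Longrightarrow> convex_const p > 0"
  by (simp add: convex_const_def)

text \<open>Identifies the constant of the stated bound with the power of \<open>p - 1\<close> that
  the recurrence produces.\<close>

lemma convex_const_powr:
  assumes "p > 1"
  shows "convex_const p powr (1 / real p) * real p = (real p - 1) powr ((real p - 1) / real p)"
proof -
  have "(y ^ p) powr (1 / real p) = y" if "y > 0" for y :: real
    using assms that by (simp add: powr_powr flip: powr_realpow)
  from this[of "1 - 1 / real p"]
  have "((1 - 1 / real p) ^ p) powr (1 / real p) = (real p - 1) / real p"
    using assms by (simp add: diff_divide_distrib)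
  then have "convex_const p powr (1 / real p) * real p = (real p - 1) / (real p - 1) powr (1 / real p)"
    using assms by (simp add: convex_const_def powr_divide)
  also have "\<dots> = (real p - 1) powr (1 - 1 / real p)"
    using assms by (simp add: powr_diff)
  also have "1 - 1 / real p = (real p - 1) / real p"
    using assms by (simp add: field_simps)
  finally show ?thesis .
qed

text \<open>With \<open>r = p - 1\<close>, raising the summands \<open>A\<close> and
  \<open>C\<close> to the power \<open>r / (r + 1)\<close> gives the two summands inside
  \<open>convex_bound\<close>; taking reciprocals in \<open>powr_add_le_two_powr\<close> yields the
  claim.\<close>

lemma recurrence_bound_le_convex_bound:
  assumes p: "p > 1" and "E > 0" "R > 0" "\<delta> > 0"
  shows "(E powr (- 1 / (real p - 1))
             + \<delta> / R powr (real p / (real p - 1)) * real k / (real p - 1)) powr (- (real p - 1))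
           \<le> convex_bound p E R \<delta> k"
proof -
  define r where "r = real p - 1"
  define A where "A = E powr (- 1 / r)"
  define C where "C = \<delta> / R powr (real p / r) * real k / r"
  define X where "X = A powr (r / (r + 1)) + C powr (r / (r + 1))"
  have r: "r > 0" "r + 1 = real p" using p by (auto simp: r_def)
  have A: "A > 0" and C: "C \<ge> 0" using assms r by (auto simp: A_def C_def)
  have X: "X > 0" using A by (simp add: X_def add_pos_nonneg)
  have Ar: "A powr (r / (r + 1)) = 1 / E powr (1 / real p)"
    using r by (simp add: A_def powr_powr flip: powr_minus_divide)
  have "C powr (r / (r + 1)) = (\<delta> * real k) powr (r / real p)
      / ((R powr (real p / r)) powr (r / real p) * r powr (r / real p))"
    using assms r by (simp add: C_def powr_divide powr_mult)
  also have "(R powr (real p / r)) powr (r / real p) = R"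
    using assms r by (simp add: powr_powr)
  also have "r powr (r / real p) = convex_const p powr (1 / real p) * real p"
    using convex_const_powr[OF p] by (simp add: r_def)
  finally have bound: "convex_bound p E R \<delta> k = 2 * X powr (- (r + 1))"
    using assms r Ar by (simp add: convex_bound_def X_def r_def mult_ac)
  have "X powr (r + 1) \<le> 2 * (A + C) powr r"
    unfolding X_def using A C r by (intro powr_add_le_two_powr) auto
  then have "(A + C) powr (- r) \<le> 2 * X powr (- (r + 1))"
    unfolding powr_minus_divide using A C X by (simp add: divide_simps)
  then show ?thesis by (simp add: bound A_def C_def r_def)
qed

text \<open>\<open>M\<close> dominates both scale factors, so it can be pulled out of the sum. It
  depends only on \<open>p\<close> and \<open>E\<close>, which makes the estimate uniform in
  \<open>R\<close>, \<open>\<delta>\<close> and \<open>k\<close>.\<close>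

lemma convex_bound_le_convex_rate:
  assumes p: "p > 1" and "E \<ge> 0"
  defines "M \<equiv> max (E powr (1 / real p)) (convex_const p powr (1 / real p))"
  assumes "R > 0" "\<delta> > 0"
  shows "convex_bound p E R \<delta> k \<le> 2 * M ^ p * convex_rate p R \<delta> k"
proof (cases "E = 0")
  case True
  then show ?thesis using assms by (simp add: convex_bound_def convex_rate_def M_def)
next
  case False
  define e c Y where "e = E powr (1 / real p)" and "c = convex_const p powr (1 / real p)"
    and "Y = 1 / (R * real p) * (\<delta> * real k) powr ((real p - 1) / real p)"
  have e: "e > 0" and c: "c > 0" and Y: "Y \<ge> 0"
    using assms False convex_const_pos[OF p] by (auto simp: e_def c_def Y_def)
  have M: "e \<le> M" "c \<le> M" by (auto simp: M_def e_def c_def)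
  have "c * Y \<le> M * Y" using M Y by (intro mult_right_mono) auto
  then have "1 + Y \<le> M / e + M * Y / c"
    using M e c by (intro add_mono) (auto simp: field_simps)
  then have le: "1 + Y \<le> M * (1 / e + Y / c)" by (simp add: field_simps)
  have pos: "1 / e + Y / c > 0" using e c Y by (intro add_pos_nonneg) auto
  have "1 / (1 / e + Y / c) ^ p = M ^ p / (M * (1 / e + Y / c)) ^ p"
    using M e by (simp add: power_mult_distrib)
  also have "\<dots> \<le> M ^ p / (1 + Y) ^ p"
    using le M e Y pos by (intro divide_left_mono power_mono mult_pos_pos zero_less_power) auto
  finally have "2 * (1 / (1 / e + Y / c) ^ p) \<le> 2 * M ^ p * (1 / (1 + Y) ^ p)" by simp
  moreover have "convex_bound p E R \<delta> k = 2 * (1 / (1 / e + Y / c) ^ p)"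
    using False pos by (simp add: convex_bound_def powr_minus_divide powr_realpow
        flip: e_def c_def Y_def) (simp add: Y_def mult_ac powr_minus_divide powr_realpow)
  ultimately show ?thesis by (simp add: convex_rate_def Y_def)
qed

lemma norm_convex_bound_le:
  assumes "p > 1" "E \<ge> 0" "R > 0" "\<delta> > 0"
  shows "norm (convex_bound p E R \<delta> k)
    \<le> 2 * max (E powr (1 / real p)) (convex_const p powr (1 / real p)) ^ p
       * norm (convex_rate p R \<delta> k)"
proof -
  have "0 \<le> convex_bound p E R \<delta> k" by (simp add: convex_bound_def)
  moreover have "0 \<le> convex_rate p R \<delta> k" using assms by (simp add: convex_rate_def)
  ultimately show ?thesis using convex_bound_le_convex_rate[OF assms] by simp
qed

text \<open>The O-claim appears in two forms: as \<open>k\<close> tends to infinity with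
  \<open>R\<close> and \<open>\<delta>\<close> fixed, and, through the principal filter, with one
  constant for all \<open>k\<close> and all positive radii and step parameters.\<close>

theorem theorem5:
  fixes B :: "'a::euclidean_space \<Rightarrow> 'a"
    and f :: "'a \<Rightarrow> real"
    and p :: nat
    and L :: "nat \<Rightarrow> real"
    and \<eta> \<delta> E0 :: real
    and xs :: 'a
    and x :: "nat \<Rightarrow> 'a"
  assumes "pos_def_self_adjoint B"
    and "p > 1"
    and "f differentiable_on UNIV"
    and "\<forall>y. f xs \<le> f y"
    and "strongly_smooth B p L f"
    and "\<eta> > 0"
    and "\<eta> powr (1 / (real p - 1)) \<le> min 1 (1 / (2 * (\<Sum>m = 2..p. L m / fact m)))"
    and "\<delta> > 0"
    and "\<delta> ^ (p - 1) = \<eta> / 2 ^ (p - 1)"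
    and "\<forall>k. x (Suc k) = rescaled_gradient_step B p \<eta> f (x k)"
    and "E0 = f (x 0) - f xs"
  shows
    "(\<forall>k\<ge>1. Min ((\<lambda>s. dual_norm B (gradient f (x s))) ` {0..k})
              \<le> (E0 / (\<delta> * real k)) powr ((real p - 1) / real p))
     \<and> (\<forall>R. convex_on UNIV f
            \<and> bdd_above ((\<lambda>y. primal_norm B (y - xs)) ` {y. f y \<le> f (x 0)})
            \<and> R = (SUP y\<in>{y. f y \<le> f (x 0)}. primal_norm B (y - xs))
          \<longrightarrow> (\<forall>k. f (x k) - f xs \<le> convex_bound p E0 R \<delta> k)
            \<and> (\<lambda>k. convex_bound p E0 R \<delta> k) \<in> O(\<lambda>k. convex_rate p R \<delta> k)
            \<and> (\<lambda>(r, d, k). convex_bound p E0 r d k)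
                \<in> O[principal {(r, d, k). r > 0 \<and> d > 0}](\<lambda>(r, d, k). convex_rate p r d k))
     \<and> (\<forall>\<mu>>0. uniformly_convex B p \<mu> f
          \<longrightarrow> (\<forall>k. f (x k) - f xs
                \<le> E0 * exp (- (real p / (real p - 1)) * \<mu> powr (1 / (real p - 1)) * \<delta> * real k)))"
proof -
  define E where "E = (\<lambda>k. f (x k) - f xs)"
  define n where "n = (\<lambda>k. dual_norm B (gradient f (x k)))"
  define r where "r = real p - 1"
  note B = assms(1) and p = assms(2) and \<delta> = assms(8)
  have r: "r > 0" "real p = r + 1" using p by (auto simp: r_def)
  have diff: "f differentiable (at y)" for y
    using assms(3) by (simp add: differentiable_on_def)
  have E_nonneg: "0 \<le> E k" for k using assms(4) by (simp add: E_def)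
  have E_0: "E0 = E 0" using assms(11) by (simp add: E_def)
  have n_nonneg: "0 \<le> n k" for k using dual_norm_nonneg[OF B] by (simp add: n_def)
  have decrease: "E (Suc k) \<le> E k - \<delta> * n k powr ((r + 1) / r)" for k
    using rescaled_gradient_step_decrease[OF B p assms(5-9), of "x k"] assms(10)
    unfolding r_def by (simp add: E_def n_def)
  have "E (Suc k) \<le> E k" for k
  proof -
    have "0 \<le> \<delta> * n k powr ((r + 1) / r)" using \<delta> by simp
    then show ?thesis using decrease[of k] by linarith
  qed
  then have "decseq E" by (rule decseq_SucI)
  then have E_le: "E k \<le> E 0" for k by (simp add: decseq_def)

  have part1: "Min (n ` {0..k}) \<le> (E0 / (\<delta> * real k)) powr ((real p - 1) / real p)"
    if "k \<ge> 1" for k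
  proof -
    define m where "m = Min (n ` {0..k})"
    have m_le: "m \<le> n s" if "s \<le> k" for s using that by (auto simp: m_def)
    have "m \<in> n ` {0..k}" unfolding m_def by (rule Min_in) auto
    then have m: "0 \<le> m" using n_nonneg by auto
    \<comment> \<open>Telescoping. Reaching \<open>E k\<close> takes only the \<open>k\<close>
      decreases at indices \<open>0\<close> to \<open>k - 1\<close>, although the minimum ranges
      over \<open>k + 1\<close> indices; hence the factor \<open>k\<close>.\<close>
    have "E j \<le> E 0 - \<delta> * real j * m powr ((r + 1) / r)" if "j \<le> k" for j
      using that
    proof (induction j)
      case (Suc j)
      have "\<delta> * m powr ((r + 1) / r) \<le> \<delta> * n j powr ((r + 1) / r)"
        using \<delta> r m m_le Suc.prems by (intro mult_left_mono powr_mono2) auto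
      then show ?case using Suc decrease[of j] by (simp add: algebra_simps)
    qed simp
    from this[of k] have "m powr ((r + 1) / r) \<le> E0 / (\<delta> * real k)"
      using E_nonneg[of k] that \<delta> by (simp add: E_0 field_simps)
    then have "(m powr ((r + 1) / r)) powr (r / (r + 1)) \<le> (E0 / (\<delta> * real k)) powr (r / (r + 1))"
      using r by (intro powr_mono2) auto
    then show ?thesis using r m by (simp add: powr_powr flip: m_def)
  qed

  have part2: "(\<forall>k. E k \<le> convex_bound p E0 R \<delta> k)
      \<and> (\<lambda>k. convex_bound p E0 R \<delta> k) \<in> O(\<lambda>k. convex_rate p R \<delta> k)"
    if conv: "convex_on UNIV f"
      and bdd: "bdd_above ((\<lambda>y. primal_norm B (y - xs)) ` {y. f y \<le> f (x 0)})"
      and R: "R = (SUP y\<in>{y. f y \<le> f (x 0)}. primal_norm B (y - xs))" for R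
  proof (cases "E0 = 0")
    \<comment> \<open>The gap stays 0 by monotonicity, matching the convention for
      \<open>convex_bound\<close>. Otherwise \<open>x 0\<close> differs from \<open>xs\<close>, so
      that \<open>R\<close> is positive.\<close>
    case True
    then show ?thesis using E_le by (simp add: convex_bound_def E_0)
  next
    case False
    then have E0: "0 < E 0" using E_nonneg[of 0] E_0 by linarith
    \<comment> \<open>Monotone decrease keeps every iterate in the initial sublevel set.\<close>
    have R_ge: "primal_norm B (x k - xs) \<le> R" for k
      unfolding R using bdd E_le[of k] by (intro cSUP_upper) (auto simp: E_def)
    have "x 0 \<noteq> xs" using E0 by (auto simp: E_def)
    then have R_pos: "0 < R"
      using primal_norm_pos[OF B, of "x 0 - xs"] R_ge[of 0] by simp
    \<comment> \<open>Inserting \<open>E k \<le> n k * R\<close> into the decrease closes the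
      recurrence in \<open>E\<close> alone.\<close>
    have "E (Suc k) \<le> E k - \<delta> / R powr ((r + 1) / r) * E k powr ((r + 1) / r)" for k
    proof -
      have "E k \<le> n k * R"
        using convex_gap_le[OF B conv diff, of "x k" xs]
          mult_left_mono[OF R_ge[of k] n_nonneg[of k]] by (simp add: E_def n_def)
      then have "(E k / R) powr ((r + 1) / r) \<le> n k powr ((r + 1) / r)"
        using R_pos E_nonneg r by (intro powr_mono2) (auto simp: field_simps)
      then have "\<delta> * (E k / R) powr ((r + 1) / r) \<le> \<delta> * n k powr ((r + 1) / r)"
        using \<delta> by simp
      then show ?thesis
        using decrease[of k] E_nonneg[of k] R_pos by (simp add: powr_divide)
    qed
    then have "E k \<le> (E 0 powr (- 1 / r) + \<delta> / R powr ((r + 1) / r) * real k / r) powr (- r)" for k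
      using \<delta> r E0 E_nonneg by (intro powr_recurrence_bound) auto
    also have "(E 0 powr (- 1 / r) + \<delta> / R powr ((r + 1) / r) * real k / r) powr (- r)
        \<le> convex_bound p E0 R \<delta> k" for k
      using recurrence_bound_le_convex_bound[OF p E0 R_pos \<delta>, of k] r by (simp add: E_0)
    finally have "\<forall>k. E k \<le> convex_bound p E0 R \<delta> k" by blast
    moreover have "(\<lambda>k. convex_bound p E0 R \<delta> k) \<in> O(\<lambda>k. convex_rate p R \<delta> k)"
      using norm_convex_bound_le[OF p E_nonneg[of 0] R_pos \<delta>]
      unfolding E_0 by (intro bigoI always_eventually allI)
    ultimately show ?thesis ..
  qed

  have uniform: "(\<lambda>(r, d, k). convex_bound p E0 r d k)
      \<in> O[principal {(r, d, k). r > 0 \<and> d > 0}](\<lambda>(r, d, k). convex_rate p r d k)"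
    using norm_convex_bound_le[OF p E_nonneg[of 0]]
    by (intro bigoI) (auto simp: eventually_principal E_0)

  have part3: "E k \<le> E0 * exp (- (real p / (real p - 1)) * \<mu> powr (1 / (real p - 1)) * \<delta> * real k)"
    if "\<mu> > 0" "uniformly_convex B p \<mu> f" for \<mu> k
  proof (induction k)
    case (Suc k)
    define c where "c = real p / (real p - 1) * \<mu> powr (1 / (real p - 1)) * \<delta>"
    have "\<delta> * (real p / (real p - 1) * \<mu> powr (1 / (real p - 1)) * E k)
        \<le> \<delta> * n k powr ((r + 1) / r)"
      using uniformly_convex_gap_le[OF B p that, of "x k" xs] \<delta>
      by (intro mult_left_mono) (simp_all add: E_def n_def r_def)
    then have "E (Suc k) \<le> (1 - c) * E k"
      using decrease[of k] by (simp add: c_def algebra_simps)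
    \<comment> \<open>\<open>1 - c \<le> exp (- c)\<close> for every real \<open>c\<close>;
      nonnegativity of \<open>E k\<close> preserves the order.\<close>
    also have "\<dots> \<le> exp (- c) * E k"
      using exp_ge_add_one_self[of "- c"] E_nonneg by (intro mult_right_mono) auto
    also have "\<dots> \<le> exp (- c) * (E0 * exp (- c * real k))"
      using Suc by (intro mult_left_mono) (auto simp: c_def)
    also have "\<dots> = E0 * exp (- c * real (Suc k))"
      by (simp add: algebra_simps exp_add[symmetric])
    finally show ?case by (simp add: c_def)
  qed (simp add: E_0)

  show ?thesis
    using part2 uniform
    by (intro conjI allI impI part1[unfolded n_def] part3[unfolded E_def]) (simp_all add: E_def)
qed

end
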